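(* For every integer $n\ge 1$, let $a_n$ denote the $n$th term of the OEIS sequence A087547, i.e. $$a_n=(n-1)!\sum_{k=0}^{n-1}\frac{\binom{2n-1}{2k}}{\binom{n-1}{k}}.$$ Then $$a_n=\frac{(n-1)!}{2}\sum_{k=0}^{n-1}\frac{\binom{2n}{2k+1}}{\binom{n-1}{k}}.$$ *)

theory Defs
  imports Complex_Main
begin

(* OEIS A087547, indexed from n = 1. The value at n = 0 is meaningless
   because of truncated subtraction. *)
definition A087547 :: "nat \<Rightarrow> real" where
  "A087547 n = fact (n - 1) *
     (\<Sum>k = 0..n - 1. real ((2 * n - 1) choose (2 * k)) / real ((n - 1) choose k))"

end

theory Submission
  imports Defs
begin

text \<open>Pascal's rule splits the right-hand sum into an even-index and an odd-index part, and the
  reflection \<open>k \<mapsto> n - 1 - k\<close> together with the symmetry of the binomial coefficients maps one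
  part to the other.\<close>

theorem theorem13:
  fixes n :: nat
  assumes "n \<ge> 1"
  shows "A087547 n = fact (n - 1) / 2 *
     (\<Sum>k = 0..n - 1. real ((2 * n) choose (2 * k + 1)) / real ((n - 1) choose k))"
proof -
  \<comment> \<open>With \<open>n = Suc m\<close> the truncated \<open>n - 1\<close> and
    \<open>2 * n - 1\<close> become \<open>m\<close> and \<open>Suc (2 * m)\<close>.\<close>
  obtain m where n: "n = Suc m"
    using assms by (cases n) auto
  define S where "S = (\<Sum>k = 0..m. real (Suc (2 * m) choose (2 * k)) / real (m choose k))"
  have "(\<Sum>k = 0..m. real (Suc (2 * m) choose (2 * k + 1)) / real (m choose k)) =
      (\<Sum>k = 0..m. real (Suc (2 * m) choose (2 * (m - k) + 1)) / real (m choose (m - k)))"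
    by (subst sum.atLeastAtMost_rev) simp
  also have "\<dots> = S"
    unfolding S_def
  proof (rule sum.cong)
    fix k assume "k \<in> {0..m}"
    then have k: "k \<le> m" by simp
    \<comment> \<open>As \<open>Suc (2 * m)\<close> is odd, complementing a lower index flips its
      parity, so odd terms become even ones.\<close>
    then have "Suc (2 * m) - 2 * k = 2 * (m - k) + 1" by simp
    then have "Suc (2 * m) choose (2 * (m - k) + 1) = Suc (2 * m) choose (2 * k)"
      using binomial_symmetric[of "2 * k" "Suc (2 * m)"] k by simp
    then show "real (Suc (2 * m) choose (2 * (m - k) + 1)) / real (m choose (m - k)) =
        real (Suc (2 * m) choose (2 * k)) / real (m choose k)"
      using binomial_symmetric[OF k] by simp
  qed simp
  finally have odd_part:
    "(\<Sum>k = 0..m. real (Suc (2 * m) choose (2 * k + 1)) / real (m choose k)) = S" .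
  \<comment> \<open>Pascal's rule applies since \<open>2 * n = Suc (Suc (2 * m))\<close>.\<close>
  have "(\<Sum>k = 0..m. real ((2 * n) choose (2 * k + 1)) / real (m choose k)) =
      S + (\<Sum>k = 0..m. real (Suc (2 * m) choose (2 * k + 1)) / real (m choose k))"
    unfolding S_def n sum.distrib[symmetric] by (simp add: add_divide_distrib)
  \<comment> \<open>The sum is thus \<open>2 * S\<close>, which cancels the factor 1/2.\<close>
  then show ?thesis
    using odd_part by (simp add: A087547_def S_def n)
qed

end
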